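(* Let $d\in\mathbb{N}$, let $t_1,t\in\mathbb{N}$ satisfy $t_1<t$, and let $\mathcal{Y}_M=\{y_1,\dots,y_M\}\subset\mathbb{S}^d$ be a spherical $t_1$-design. Then for all sufficiently large $N$ there exists a point set $\mathcal{X}_N=\{x_1,\dots,x_N\}\subset\mathbb{S}^d$ such that $\mathcal{X}_N\cup\mathcal{Y}_M$ is a spherical $t$-design.
   Context: $\mathbb{S}^d=\{x\in\mathbb{R}^{d+1}:|x|=1\}$, and $\mu_d$ is the normalized Lebesgue (surface) measure with $\mu_d(\mathbb{S}^d)=1$. All point sets are finite multisets (points may coincide), and unions are multiset unions, so $\mathcal{X}_N\cup\mathcal{Y}_M$ has $N+M$ points counted with multiplicity. For $s\in\mathbb{N}$, a multiset $\{z_1,\dots,z_K\}\subset\mathbb{S}^d$ is a spherical $s$-design if $\int_{\mathbb{S}^d}P(x)\,d\mu_d(x)=\frac1K\sum_{i=1}^K P(z_i)$ for all real polynomials $P$ in $d+1$ variables of degree at most $s$. *)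

theory Defs
  imports "HOL-Analysis.Analysis" "HOL-Library.Multiset" "HOL-Library.Poly_Mapping"
begin

text \<open>
  A real polynomial in variables indexed by \<open>'n\<close> is a finitely supported map from exponent vectors
  to coefficients.
\<close>

type_synonym 'n real_mpoly = "('n \<Rightarrow>\<^sub>0 nat) \<Rightarrow>\<^sub>0 real"

definition mpoly_eval :: "'n::finite real_mpoly \<Rightarrow> real ^ 'n \<Rightarrow> real" where
  "mpoly_eval P x =
     (\<Sum>m\<in>Poly_Mapping.keys P. Poly_Mapping.lookup P m * (\<Prod>i\<in>UNIV. (x $ i) ^ Poly_Mapping.lookup m i))"

text \<open>The zero polynomial gets degree 0.\<close>

definition mpoly_degree :: "'n::finite real_mpoly \<Rightarrow> nat" where
  "mpoly_degree P =
     Max (insert 0 ((\<lambda>m. \<Sum>i\<in>UNIV. Poly_Mapping.lookup m i) ` Poly_Mapping.keys P))"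

text \<open>
  Normalized surface measure on the unit sphere by the usual cone construction: the measure of \<open>A\<close>
  is the volume of the cone \<open>{r *\<^sub>R x | 0 < r < 1, x \<in> A}\<close> divided by the volume of the unit ball
  (see \<open>emeasure_sphere_measure\<close> below). Radial projection is \<open>sgn x = x /\<^sub>R norm x\<close>; the restriction
  only discards \<open>sgn 0 = 0\<close>, which carries no mass.
\<close>

definition sphere_measure :: "'a::euclidean_space measure" where
  "sphere_measure =
     restrict_space (distr (uniform_measure lborel (ball 0 1)) borel sgn) (sphere 0 1)"

definition spherical_design :: "nat \<Rightarrow> (real ^ 'n::finite) multiset \<Rightarrow> bool" where
  "spherical_design s Z \<longleftrightarrow>
     Z \<noteq> {#} \<and> set_mset Z \<subseteq> sphere 0 1 \<and>
     (\<forall>P. mpoly_degree P \<le> s \<longrightarrow>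
        (\<integral>x. mpoly_eval P x \<partial>sphere_measure) = (1 / real (size Z)) * (\<Sum>z\<in>#Z. mpoly_eval P z))"

lemma space_sphere_measure [simp]: "space sphere_measure = sphere 0 1"
  by (simp add: sphere_measure_def space_restrict_space)

lemma sgn_borel [measurable]: "(sgn :: 'a::euclidean_space \<Rightarrow> 'a) \<in> borel_measurable borel"
  unfolding sgn_div_norm by measurable

lemma sets_sphere_measure:
  "sets (sphere_measure :: 'a::euclidean_space measure) = sets (restrict_space borel (sphere 0 1))"
  by (simp add: sphere_measure_def sets_restrict_space)

lemma cone_eq:
  fixes A :: "'a::euclidean_space set"
  assumes "A \<subseteq> sphere 0 1"
  shows "{r *\<^sub>R x | r x. 0 < r \<and> r < 1 \<and> x \<in> A} = ball 0 1 \<inter> sgn -` A" (is "?R = ?L")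
proof (intro set_eqI iffI)
  fix y assume y: "y \<in> ?L"
  then have "y \<noteq> 0" using assms by auto
  moreover from this have "y = norm y *\<^sub>R sgn y" by (simp add: sgn_div_norm)
  ultimately show "y \<in> ?R"
    using y by (smt (verit) Int_iff dist_0_norm mem_Collect_eq mem_ball vimage_eq zero_less_norm_iff)
next
  fix y assume "y \<in> ?R"
  then obtain r x where "y = r *\<^sub>R x" "0 < r" "r < 1" "x \<in> A" by blast
  moreover have "norm x = 1" using assms \<open>x \<in> A\<close> by auto
  ultimately show "y \<in> ?L" by (simp add: sgn_scaleR) (simp add: sgn_div_norm)
qed

lemma sgn_vimage_borel: "A \<in> sets borel \<Longrightarrow> sgn -` A \<in> sets (borel :: 'a::euclidean_space measure)"
  using measurable_sets[OF sgn_borel] by simp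

lemma emeasure_sphere_measure:
  fixes A :: "'a::euclidean_space set"
  assumes A: "A \<in> sets borel" "A \<subseteq> sphere 0 1"
  shows "emeasure sphere_measure A =
    emeasure lborel {r *\<^sub>R x | r x. 0 < r \<and> r < 1 \<and> x \<in> A} / emeasure lborel (ball 0 1 :: 'a set)"
proof -
  have "emeasure sphere_measure A = emeasure (distr (uniform_measure lborel (ball 0 1)) borel sgn) A"
    unfolding sphere_measure_def using A by (intro emeasure_restrict_space) auto
  also have "\<dots> = emeasure (uniform_measure lborel (ball 0 1)) (sgn -` A)"
    using A by (subst emeasure_distr) auto
  also have "\<dots> = emeasure lborel (ball 0 1 \<inter> sgn -` A) / emeasure lborel (ball 0 1 :: 'a set)"
    using sgn_vimage_borel[OF A(1)] by (intro emeasure_uniform_measure) auto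
  finally show ?thesis unfolding cone_eq[OF A(2)] .
qed

lemma emeasure_space_sphere_measure: "emeasure sphere_measure (sphere (0::'a::euclidean_space) 1) = 1"
proof -
  let ?B = "ball 0 1 :: 'a set"
  have "?B \<inter> sgn -` sphere 0 1 = ?B - {0}"
    by (auto simp: norm_sgn)
  moreover have "emeasure lborel (?B - {0}) = emeasure lborel ?B"
    by (intro emeasure_Diff_null_set) auto
  moreover have "emeasure lborel ?B / emeasure lborel ?B = 1"
  proof (rule ennreal_divide_self)
    have "emeasure lborel ?B \<noteq> 0 \<or> ?B = {}"
      using open_not_negligible[OF open_ball, of "0::'a" 1]
      by (auto simp: negligible_iff_null_sets null_sets_def)
    then show "emeasure lborel ?B \<noteq> 0" by simp
    show "emeasure lborel ?B < top" using emeasure_lborel_ball_finite[of "0::'a" 1] by simp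
  qed
  ultimately show ?thesis
    by (simp only: emeasure_sphere_measure[OF _ order_refl] cone_eq[OF order_refl]
        borel_closed[OF closed_sphere])
qed

end

theory Submission
  imports Defs "HOL-Probability.Probability_Measure"
begin

text \<open>
  On the sphere, fix a basis of the polynomial functions of degree at most \<open>t\<close> with mean zero, and
  collect it into a continuous map \<open>f\<close> from the sphere to some \<open>\<real>\<^sup>m\<close>. The union of \<open>X\<close> and \<open>Y\<close> is a
  \<open>t\<close>-design iff \<open>\<Sum>x\<in>X. f x\<close> equals the fixed vector \<open>v = - (\<Sum>y\<in>Y. f y)\<close>. So it is enough that the
  \<open>N\<close>-fold sums of values of \<open>f\<close> reach every given vector once \<open>N\<close> is large. This is the averaging-set
  argument of Seymour and Zaslavsky, and it only uses that the sphere is compact and path connected and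
  that the surface measure is a probability measure charging every nonempty open set. The theorem
  \<open>averaging_multiset_extension\<close> is stated for such spaces and arbitrary continuous functions.

  Full support makes \<open>\<integral> h\<^sup>2 = 0\<close> force \<open>h = 0\<close>, so Gram--Schmidt lets us take the components of \<open>f\<close>
  orthonormal (\<open>gram_schmidt\<close>). For a small constant \<open>c\<close> and \<open>u\<close> in the cube \<open>[-1, 1]\<^sup>m\<close>, the density
  \<open>1 + c (u \<bullet> f)\<close> is positive and has moment vector \<open>\<integral> f (1 + c (u \<bullet> f)) = c u\<close>. A Riemann sum
  (\<open>riemann_weights\<close>) replaces it by weights on finitely many fixed points \<open>p 0, ..., p n\<close>, depending
  continuously on \<open>u\<close>, with moment vector still close to \<open>c u\<close>.

  Weights have to be turned into \<open>N\<close> honest points that still move continuously with \<open>u\<close>. Join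
  \<open>p 0, ..., p n\<close> by a path and let each of the \<open>N\<close> points travel along it as the weights vary. At any
  moment at most \<open>n\<close> of them are under way between two of the \<open>p j\<close>, and all others sit at the \<open>p j\<close> in
  nearly the prescribed proportions. The sum of \<open>f\<close> over the points therefore differs from \<open>N\<close> times the
  weighted mean by an amount bounded independently of \<open>N\<close> (\<open>path_sums\<close>). Since the moment vector times
  \<open>N\<close> grows linearly on the faces of the cube, for large \<open>N\<close> the \<open>k\<close>-th component of the sum minus \<open>v\<close>
  is nonpositive on the face \<open>u k = -1\<close> and nonnegative on \<open>u k = 1\<close>. The theorem of Poincare and Miranda
  then gives a \<open>u\<close> at which the sum is exactly \<open>v\<close>.
\<close>

section \<open>The Poincare--Miranda theorem\<close>

text \<open>
  The dimension of the cube will be the dimension of a space of functions, which no type describes; so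
  its points are sequences that vanish from index \<open>n\<close> on, with the topology of pointwise convergence.
\<close>

definition unit_cube :: "nat \<Rightarrow> (nat \<Rightarrow> real) set" where
  "unit_cube n = {u. \<forall>k. if k < n then \<bar>u k\<bar> \<le> 1 else u k = 0}"

lemma compact_unit_cube: "compact (unit_cube n)"
proof -
  have eq: "unit_cube n = PiE UNIV (\<lambda>k. if k < n then {-1..1} else {0})"
    by (auto simp: unit_cube_def PiE_iff abs_le_iff split: if_splits)
  have "compactin (product_topology (\<lambda>_. euclidean) UNIV) (unit_cube n)"
    unfolding eq compactin_PiE by auto
  then show ?thesis
    by (simp add: euclidean_product_topology)
qed

lemma tendsto_fun_iff:
  fixes f :: "'b \<Rightarrow> 'i \<Rightarrow> 'a::topological_space"
  shows "(f \<longlongrightarrow> l) F \<longleftrightarrow> (\<forall>i. ((\<lambda>x. f x i) \<longlongrightarrow> l i) F)"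
  using limitin_componentwise[of "\<lambda>_. euclidean" UNIV f l F]
  by (simp add: euclidean_product_topology)

text \<open>
  Label the grid points of mesh \<open>2 / Suc m\<close> by the sign of each \<open>F k\<close>; the boundary conditions are those
  of Kuhn's lemma. It yields, for every mesh and every \<open>k\<close>, two points in a common small cell at which
  \<open>F k\<close> has opposite signs. A limit point of these cells is a common zero.
\<close>

theorem poincare_miranda:
  fixes F :: "nat \<Rightarrow> (nat \<Rightarrow> real) \<Rightarrow> real"
  assumes cont: "\<And>k. k < n \<Longrightarrow> continuous_on (unit_cube n) (F k)"
    and neg: "\<And>k u. k < n \<Longrightarrow> u \<in> unit_cube n \<Longrightarrow> u k = -1 \<Longrightarrow> F k u \<le> 0"
    and pos: "\<And>k u. k < n \<Longrightarrow> u \<in> unit_cube n \<Longrightarrow> u k = 1 \<Longrightarrow> F k u \<ge> 0"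
  shows "\<exists>u\<in>unit_cube n. \<forall>k<n. F k u = 0"
proof -
  have approx: "\<exists>x\<in>unit_cube n. \<forall>i<n. \<exists>y\<in>unit_cube n. \<exists>z\<in>unit_cube n.
      F i y \<le> 0 \<and> 0 \<le> F i z \<and>
      (\<forall>j. \<bar>y j - x j\<bar> \<le> 2 / real (Suc m) \<and> \<bar>z j - x j\<bar> \<le> 2 / real (Suc m))" for m
  proof -
    define p where "p = Suc m"
    have p: "0 < p" by (simp add: p_def)
    define pt where "pt = (\<lambda>q k. if k < n then 2 * real (q k) / real p - 1 else 0)"
    \<comment> \<open>On the faces the label is dictated by the face, because the sign of \<open>F i\<close> may be zero there.\<close>
    define label :: "(nat \<Rightarrow> nat) \<Rightarrow> nat \<Rightarrow> nat"
      where "label = (\<lambda>q i. if q i \<noteq> 0 \<and> (q i = p \<or> 0 < F i (pt q)) then 1 else 0)"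
    have pt_cube: "pt q \<in> unit_cube n" if "\<forall>k<n. q k \<le> p" for q
    proof -
      have "0 \<le> 2 * real (q k) / real p" "2 * real (q k) / real p \<le> 2" if "k < n" for k
        using that \<open>\<forall>k<n. q k \<le> p\<close> p by (auto simp: field_simps)
      then show ?thesis
        unfolding unit_cube_def pt_def by (auto simp: abs_le_iff)
    qed
    obtain q where q: "\<forall>i<n. q i < p"
      and rs: "\<forall>i<n. \<exists>r s. (\<forall>j<n. q j \<le> r j \<and> r j \<le> q j + 1) \<and>
        (\<forall>j<n. q j \<le> s j \<and> s j \<le> q j + 1) \<and> label r i \<noteq> label s i"
      by (rule kuhn_lemma[OF p, of n label]) (auto simp: label_def p)
    have label0: "F i (pt r) \<le> 0" if "label r i = 0" "i < n" "\<forall>k<n. r k \<le> p" for r i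
    proof (cases "r i = 0")
      case True
      then have "pt r i = -1" using that by (simp add: pt_def)
      then show ?thesis using neg pt_cube that by blast
    qed (use that in \<open>auto simp: label_def split: if_splits\<close>)
    have label1: "F i (pt r) \<ge> 0" if "label r i \<noteq> 0" "i < n" "\<forall>k<n. r k \<le> p" for r i
    proof (cases "r i = p")
      case True
      then have "pt r i = 1" using that p by (simp add: pt_def)
      then show ?thesis using pos pt_cube that by blast
    qed (use that in \<open>auto simp: label_def split: if_splits\<close>)
    have near: "\<bar>pt r j - pt q j\<bar> \<le> 2 / real (Suc m)"
      if "\<forall>j<n. q j \<le> r j \<and> r j \<le> q j + 1" for r j
    proof (cases "j < n")
      case True
      have "pt r j - pt q j = 2 * (real (r j) - real (q j)) / real p"
        using True by (simp add: pt_def diff_divide_distrib right_diff_distrib)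
      moreover have "\<bar>real (r j) - real (q j)\<bar> \<le> 1"
      proof -
        have "q j \<le> r j" "r j \<le> q j + 1" using that True by auto
        then show ?thesis by linarith
      qed
      ultimately show ?thesis
        using p by (simp add: p_def[symmetric] abs_mult divide_right_mono)
    qed (simp add: pt_def)
    show ?thesis
    proof (rule bexI[of _ "pt q"], intro allI impI)
      show "pt q \<in> unit_cube n" using q by (intro pt_cube) (auto intro: less_imp_le)
      fix i assume i: "i < n"
      let ?nb = "\<lambda>r. \<forall>j<n. q j \<le> r j \<and> r j \<le> q j + 1"
      obtain r' s' where "?nb r'" "?nb s'" "label r' i \<noteq> label s' i"
        using rs i by blast
      then obtain r s where r: "?nb r" and s: "?nb s" and "label r i = 0" "label s i \<noteq> 0"
        by (cases "label r' i = 0") (auto simp: label_def split: if_splits)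
      moreover have "\<forall>k<n. t k \<le> p" if "?nb t" for t
      proof (intro allI impI)
        fix k assume "k < n"
        then have "t k \<le> q k + 1" "q k < p" using that q by auto
        then show "t k \<le> p" by simp
      qed
      ultimately show "\<exists>y\<in>unit_cube n. \<exists>z\<in>unit_cube n. F i y \<le> 0 \<and> 0 \<le> F i z \<and>
          (\<forall>j. \<bar>y j - pt q j\<bar> \<le> 2 / real (Suc m) \<and> \<bar>z j - pt q j\<bar> \<le> 2 / real (Suc m))"
        using label0[of r i] label1[of s i] near[of r] near[of s] i pt_cube[of r] pt_cube[of s] r s by blast
    qed
  qed
  then obtain x where x: "x m \<in> unit_cube n"
    and "\<forall>i<n. \<exists>y\<in>unit_cube n. \<exists>z\<in>unit_cube n. F i y \<le> 0 \<and> 0 \<le> F i z \<and>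
      (\<forall>j. \<bar>y j - x m j\<bar> \<le> 2 / real (Suc m) \<and> \<bar>z j - x m j\<bar> \<le> 2 / real (Suc m))" for m
    by metis
  then obtain y z where yz: "\<And>m i. i < n \<Longrightarrow> y m i \<in> unit_cube n \<and> z m i \<in> unit_cube n \<and>
      F i (y m i) \<le> 0 \<and> 0 \<le> F i (z m i) \<and>
      (\<forall>j. \<bar>y m i j - x m j\<bar> \<le> 2 / real (Suc m) \<and> \<bar>z m i j - x m j\<bar> \<le> 2 / real (Suc m))"
    by metis
  obtain l \<phi> where l: "l \<in> unit_cube n" and \<phi>: "strict_mono \<phi>" and lim: "(x \<circ> \<phi>) \<longlonglongrightarrow> l"
    using compact_unit_cube x unfolding compact_def by metis
  have mesh: "(\<lambda>m. 2 / real (Suc (\<phi> m))) \<longlonglongrightarrow> 0"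
    using LIMSEQ_subseq_LIMSEQ[OF LIMSEQ_Suc[OF lim_const_over_n[of 2]] \<phi>] by (simp add: o_def)
  have close: "(\<lambda>m. w (\<phi> m)) \<longlonglongrightarrow> l"
    if "\<And>m j. \<bar>w m j - x m j\<bar> \<le> 2 / real (Suc m)" for w :: "nat \<Rightarrow> nat \<Rightarrow> real"
    unfolding tendsto_fun_iff
  proof
    fix j
    have "(\<lambda>m. w (\<phi> m) j - x (\<phi> m) j) \<longlonglongrightarrow> 0"
      by (rule Lim_null_comparison[OF _ mesh]) (use that in auto)
    moreover have "(\<lambda>m. x (\<phi> m) j) \<longlonglongrightarrow> l j"
      using lim by (simp add: tendsto_fun_iff o_def)
    ultimately show "(\<lambda>m. w (\<phi> m) j) \<longlonglongrightarrow> l j"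
      using tendsto_add by fastforce
  qed
  have "F i l = 0" if "i < n" for i
  proof (rule antisym)
    have "(\<lambda>m. F i (y (\<phi> m) i)) \<longlonglongrightarrow> F i l"
      by (rule continuous_on_tendsto_compose[OF cont[OF that] _ l, where g = "\<lambda>m. y (\<phi> m) i"])
        (use that yz close[of "\<lambda>m. y m i"] in auto)
    then show "F i l \<le> 0"
      by (rule LIMSEQ_le_const2) (use yz that in auto)
    have "(\<lambda>m. F i (z (\<phi> m) i)) \<longlonglongrightarrow> F i l"
      by (rule continuous_on_tendsto_compose[OF cont[OF that] _ l, where g = "\<lambda>m. z (\<phi> m) i"])
        (use that yz close[of "\<lambda>m. z m i"] in auto)
    then show "0 \<le> F i l"
      by (rule LIMSEQ_le_const) (use yz that in auto)
  qed
  then show ?thesis using l by blast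
qed

section \<open>Riemann sums on a compact probability space\<close>

locale compact_prob_space = prob_space M for M :: "'a::metric_space measure" +
  fixes S :: "'a set"
  assumes compact_S: "compact S"
    and space_eq: "space M = S"
    and sets_eq: "sets M = sets (restrict_space borel S)"
begin

lemma measurable_cont:
  fixes g :: "'a \<Rightarrow> real"
  assumes "continuous_on S g"
  shows "g \<in> borel_measurable M"
  using borel_measurable_continuous_on_restrict[OF assms] measurable_cong_sets[OF sets_eq refl, of borel]
  by blast

lemma bounded_cont:
  fixes g :: "'a \<Rightarrow> real"
  assumes "continuous_on S g"
  obtains B where "\<And>x. x \<in> S \<Longrightarrow> \<bar>g x\<bar> \<le> B"
proof -
  have "bounded (g ` S)"
    using compact_imp_bounded[OF compact_continuous_image[OF assms compact_S]] .
  then obtain B where "\<forall>x\<in>S. \<bar>g x\<bar> \<le> B" by (auto simp: bounded_iff)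
  then show ?thesis using that by blast
qed

lemma integrable_cont:
  fixes g :: "'a \<Rightarrow> real"
  assumes "continuous_on S g"
  shows "integrable M g"
proof -
  obtain B where "\<And>x. x \<in> S \<Longrightarrow> \<bar>g x\<bar> \<le> B"
    using bounded_cont[OF assms] by blast
  then show ?thesis
    by (intro integrable_const_bound[of _ B] measurable_cont assms) (auto simp: space_eq)
qed

text \<open>
  Finitely many balls on which every function in \<open>G\<close> oscillates by less than \<open>\<epsilon>\<close> cover \<open>S\<close>. Assigning
  each point to the first ball that contains it gives a measurable partition, and the weights are the
  measures of its cells. The same weights serve all of \<open>G\<close>.
\<close>

lemma riemann_weights:
  fixes G :: "('a \<Rightarrow> real) set"
  assumes G: "finite G" "\<And>g. g \<in> G \<Longrightarrow> continuous_on S g" and "\<epsilon> > 0"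
  obtains n :: nat and p w where "\<And>j. j \<le> n \<Longrightarrow> p j \<in> S" "\<And>j. 0 \<le> w j" "(\<Sum>j\<le>n. w j) = (1::real)"
    "\<And>g. g \<in> G \<Longrightarrow> \<bar>(\<Sum>j\<le>n. w j * g (p j)) - (\<integral>x. g x \<partial>M)\<bar> \<le> \<epsilon>"
proof -
  have "\<exists>d>0. \<forall>y\<in>S. dist y x < d \<longrightarrow> (\<forall>g\<in>G. \<bar>g y - g x\<bar> < \<epsilon>)" if "x \<in> S" for x
  proof -
    have "\<forall>\<^sub>F y in at x within S. \<bar>g y - g x\<bar> < \<epsilon>" if "g \<in> G" for g
    proof -
      have "(g \<longlongrightarrow> g x) (at x within S)"
        using G(2)[OF that] \<open>x \<in> S\<close> unfolding continuous_on_def by blast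
      then show ?thesis
        using \<open>\<epsilon> > 0\<close> unfolding tendsto_iff dist_real_def by blast
    qed
    then have "\<forall>\<^sub>F y in at x within S. \<forall>g\<in>G. \<bar>g y - g x\<bar> < \<epsilon>"
      by (intro eventually_ball_finite[OF G(1)] ballI)
    then obtain d where "d > 0"
      and d: "\<forall>y\<in>S. y \<noteq> x \<and> dist y x < d \<longrightarrow> (\<forall>g\<in>G. \<bar>g y - g x\<bar> < \<epsilon>)"
      unfolding eventually_at by blast
    have "\<bar>g y - g x\<bar> < \<epsilon>" if "y \<in> S" "dist y x < d" "g \<in> G" for y g
      using d that \<open>\<epsilon> > 0\<close> by (cases "y = x") auto
    then show ?thesis using \<open>d > 0\<close> by blast
  qed
  then obtain d where d: "\<And>x. x \<in> S \<Longrightarrow> d x > 0"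
    and osc: "\<And>x y g. x \<in> S \<Longrightarrow> y \<in> S \<Longrightarrow> dist y x < d x \<Longrightarrow> g \<in> G \<Longrightarrow> \<bar>g y - g x\<bar> < \<epsilon>"
    by metis
  obtain D where D: "D \<subseteq> S" "finite D" "S \<subseteq> (\<Union>x\<in>D. ball x (d x))"
    by (rule compactE_image[OF compact_S, of S "\<lambda>x. ball x (d x)"]) (use d in force)+
  have "S \<noteq> {}" using not_empty by (simp add: space_eq)
  then have "D \<noteq> {}" using D by auto
  obtain p where p: "bij_betw p {0..<card D} D" using ex_bij_betw_nat_finite[OF D(2)] by blast
  define n where "n = card D - 1"
  have "card D > 0" using D(2) \<open>D \<noteq> {}\<close> by (simp add: card_gt_0_iff)
  then have "{0..<card D} = {..n}" by (auto simp: n_def)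
  then have pD: "p ` {..n} = D" using p by (simp add: bij_betw_def)
  define B where "B = (\<lambda>j. ball (p j) (d (p j)))"
  define idx where "idx = (\<lambda>x. LEAST j. x \<in> B j)"
  define A where "A = (\<lambda>j. {x \<in> S. idx x = j})"
  have idx: "idx x \<le> n" "x \<in> B (idx x)" if "x \<in> S" for x
  proof -
    obtain j where "j \<le> n" "x \<in> B j"
    proof -
      obtain c where "c \<in> D" "x \<in> ball c (d c)" using D(3) \<open>x \<in> S\<close> by blast
      moreover have "c \<in> p ` {..n}" using pD \<open>c \<in> D\<close> by simp
      ultimately show thesis using that unfolding B_def by auto
    qed
    then have "idx x \<le> j" and "x \<in> B (idx x)"
      unfolding idx_def by (auto intro: Least_le LeastI)
    with \<open>j \<le> n\<close> show "idx x \<le> n" "x \<in> B (idx x)" by auto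
  qed
  have A_meas: "A j \<in> sets M" if "j \<le> n" for j
  proof -
    have "idx x = j \<longleftrightarrow> x \<in> B j \<and> (\<forall>i<j. x \<notin> B i)" if "x \<in> S" for x
      using idx(2)[OF that] unfolding idx_def
      by (metis Least_equality linorder_not_less not_less_Least)
    then have "A j = S \<inter> (B j - (\<Union>i<j. B i))"
      by (auto simp: A_def)
    then show ?thesis
      using compact_imp_closed[OF compact_S] unfolding B_def
      by (auto simp: sets_eq sets_restrict_space)
  qed
  define w where "w = (\<lambda>j. measure M (A j))"
  have step: "(\<Sum>j\<le>n. indicator (A j) x * c j) = (c (idx x) :: real)" if "x \<in> S" for x c
  proof -
    have "(\<Sum>j\<le>n. indicator (A j) x * c j) = (\<Sum>j\<le>n. if j = idx x then c j else 0)"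
      using that by (intro sum.cong) (auto simp: A_def indicator_def)
    then show ?thesis using idx(1)[OF that] by simp
  qed
  have ind: "integrable M (\<lambda>x. indicator (A j) x * (c j::real))" if "j \<le> n" for j c
    using A_meas[OF that] by (simp add: integrable_real_indicator emeasure_eq_measure)
  have int: "integrable M (\<lambda>x. \<Sum>j\<le>n. indicator (A j) x * (c j::real))" for c
    by (intro Bochner_Integration.integrable_sum ind) simp
  have int_eq: "(\<integral>x. (\<Sum>j\<le>n. indicator (A j) x * c j) \<partial>M) = (\<Sum>j\<le>n. w j * c j)" for c
  proof -
    have "(\<integral>x. (\<Sum>j\<le>n. indicator (A j) x * c j) \<partial>M) = (\<Sum>j\<le>n. \<integral>x. indicator (A j) x * c j \<partial>M)"
      by (intro Bochner_Integration.integral_sum ind) simp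
    also have "\<dots> = (\<Sum>j\<le>n. w j * c j)"
      using A_meas by (intro sum.cong) (auto simp: w_def)
    finally show ?thesis .
  qed
  show thesis
  proof (rule that[of n p w])
    show "p j \<in> S" if "j \<le> n" for j using that pD D(1) by auto
    show "0 \<le> w j" for j by (simp add: w_def)
    have "(\<Sum>j\<le>n. w j * 1) = (\<integral>x. 1 \<partial>M)"
      unfolding int_eq[symmetric] by (intro Bochner_Integration.integral_cong) (simp_all only: space_eq step)
    then show "(\<Sum>j\<le>n. w j) = 1" by (simp add: prob_space)
    fix g assume g: "g \<in> G"
    have gi: "integrable M g" using G(2) g integrable_cont by blast
    let ?s = "\<lambda>x. \<Sum>j\<le>n. indicator (A j) x * g (p j)"
    have "\<bar>(\<integral>x. ?s x \<partial>M) - (\<integral>x. g x \<partial>M)\<bar> = \<bar>\<integral>x. ?s x - g x \<partial>M\<bar>"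
      by (subst Bochner_Integration.integral_diff[OF int gi]) simp
    also have "\<dots> \<le> (\<integral>x. \<bar>?s x - g x\<bar> \<partial>M)"
      by (rule integral_abs_bound)
    also have "\<dots> \<le> (\<integral>x. \<epsilon> \<partial>M)"
    proof (rule integral_mono)
      fix x assume "x \<in> space M"
      then have x: "x \<in> S" by (simp add: space_eq)
      have "p (idx x) \<in> S" using idx(1)[OF x] pD D(1) by auto
      moreover have "dist x (p (idx x)) < d (p (idx x))"
        using idx(2)[OF x] by (simp add: B_def dist_commute)
      ultimately have "\<bar>g x - g (p (idx x))\<bar> < \<epsilon>" using osc x g by blast
      then show "\<bar>?s x - g x\<bar> \<le> \<epsilon>" unfolding step[OF x] by simp
    qed (use int gi in auto)
    also have "\<dots> = \<epsilon>" by (simp add: prob_space)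
    finally show "\<bar>(\<Sum>j\<le>n. w j * g (p j)) - (\<integral>x. g x \<partial>M)\<bar> \<le> \<epsilon>"
      unfolding int_eq .
  qed
qed

end

section \<open>Moving points along a path\<close>

lemma path_through_points:
  fixes p :: "nat \<Rightarrow> 'a::topological_space"
  assumes S: "path_connected S" and "\<And>j. j \<le> n \<Longrightarrow> p j \<in> S"
  shows "\<exists>\<gamma>. continuous_on {0..real n} \<gamma> \<and> \<gamma> ` {0..real n} \<subseteq> S \<and> (\<forall>j\<le>n. \<gamma> (real j) = p j)"
  using assms(2)
proof (induction n)
  case 0
  then show ?case by (intro exI[of _ "\<lambda>_. p 0"]) auto
next
  case (Suc n)
  then obtain \<gamma> where \<gamma>: "continuous_on {0..real n} \<gamma>" "\<gamma> ` {0..real n} \<subseteq> S" "\<forall>j\<le>n. \<gamma> (real j) = p j"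
    by auto
  obtain g where g: "path g" "path_image g \<subseteq> S" "pathstart g = p n" "pathfinish g = p (Suc n)"
  proof -
    have "p n \<in> S" "p (Suc n) \<in> S" using Suc.prems by auto
    then have "\<exists>g. path g \<and> path_image g \<subseteq> S \<and> pathstart g = p n \<and> pathfinish g = p (Suc n)"
      by (rule S[unfolded path_connected_def, rule_format])
    then show thesis using that by blast
  qed
  define \<delta> where "\<delta> = (\<lambda>x. if x \<le> real n then \<gamma> x else g (x - real n))"
  have split: "{0..real (Suc n)} = {0..real n} \<union> {real n..real (Suc n)}" by auto
  have "continuous_on {real n..real (Suc n)} (\<lambda>x. g (x - real n))"
    by (rule continuous_on_compose2[OF g(1)[unfolded path_def]]) (auto intro!: continuous_intros)
  then have "continuous_on {0..real (Suc n)} \<delta>"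
    unfolding \<delta>_def split using \<gamma> g(3)
    by (intro continuous_on_cases) (auto simp: pathstart_def)
  moreover have "\<delta> x \<in> S" if "x \<in> {0..real (Suc n)}" for x
  proof (cases "x \<le> real n")
    case False
    then have "g (x - real n) \<in> path_image g" using that by (auto simp: path_image_def)
    then show ?thesis using False g(2) by (auto simp: \<delta>_def)
  qed (use \<gamma>(2) that in \<open>auto simp: \<delta>_def\<close>)
  moreover have "\<delta> (real j) = p j" if "j \<le> Suc n" for j
    using that \<gamma>(3) g(4) by (cases "j = Suc n") (auto simp: \<delta>_def pathfinish_def)
  ultimately show ?case by (intro exI[of _ \<delta>]) auto
qed

text \<open>
  A point that has passed the first \<open>s\<close> thresholds and no others stands at \<open>p s\<close>; written as a sum over
  all thresholds, its value can be summed over the points one threshold at a time.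
\<close>

lemma telescope_initial_segment:
  fixes f :: "nat \<Rightarrow> real"
  assumes "\<And>j k. j < n \<Longrightarrow> b j \<Longrightarrow> k < j \<Longrightarrow> b k"
  shows "f 0 + (\<Sum>j<n. of_bool (b j) * (f (Suc j) - f j)) = f (\<Sum>j<n. of_bool (b j))"
  using assms
proof (induction n)
  case (Suc n)
  show ?case
  proof (cases "b n")
    case True
    then have "b j" if "j < n" for j using Suc.prems that by auto
    then have "(\<Sum>j<Suc n. of_bool (b j)) = Suc n"
      and "(\<Sum>j<Suc n. of_bool (b j) * (f (Suc j) - f j)) = (\<Sum>j<Suc n. f (Suc j) - f j)"
      using True by simp_all
    then show ?thesis by (simp only: sum_lessThan_telescope)
  next
    case False
    have "f 0 + (\<Sum>j<n. of_bool (b j) * (f (Suc j) - f j)) = f (\<Sum>j<n. of_bool (b j))"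
      using Suc.prems less_SucI by (intro Suc.IH) blast
    with False show ?thesis by (simp del: sum_of_bool_mult_eq sum_mult_of_bool_eq)
  qed
qed simp

lemma sum_by_parts:
  fixes l f :: "nat \<Rightarrow> real"
  shows "(\<Sum>j\<le>n. l j * f j) = (\<Sum>j\<le>n. l j) * f 0 + (\<Sum>j<n. ((\<Sum>k\<le>n. l k) - (\<Sum>k\<le>j. l k)) * (f (Suc j) - f j))"
proof (induction n)
  case (Suc n)
  have "(\<Sum>j<Suc n. ((\<Sum>k\<le>Suc n. l k) - (\<Sum>k\<le>j. l k)) * (f (Suc j) - f j))
     = (\<Sum>j<n. ((\<Sum>k\<le>n. l k) - (\<Sum>k\<le>j. l k)) * (f (Suc j) - f j)) + l (Suc n) * (\<Sum>j<Suc n. f (Suc j) - f j)"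
    by (simp add: sum.distrib[symmetric] sum_distrib_left algebra_simps)
  also have "(\<Sum>j<Suc n. f (Suc j) - f j) = f (Suc n) - f 0"
    by (rule sum_lessThan_telescope)
  finally show ?case using Suc by (simp add: algebra_simps)
qed simp

text \<open>
  Both rounding errors in the comparison below are counts of integers: the points \<open>i\<close> beyond a real
  threshold \<open>a\<close>, and the points that are just passing it.
\<close>

lemma count_above:
  fixes a :: real
  assumes "0 \<le> a" "a \<le> real N"
  shows "\<bar>(\<Sum>i<N. of_bool (a \<le> real i)) - (real N - a)\<bar> \<le> 1"
proof -
  have "{i \<in> {..<N}. a \<le> real i} = {nat \<lceil>a\<rceil>..<N}"
    by (auto simp: nat_le_iff ceiling_le_iff)
  then have "(\<Sum>i<N. of_bool (a \<le> real i)) = real (N - nat \<lceil>a\<rceil>)"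
    by (simp add: of_bool_def sum.If_cases Int_def flip: sum.inter_filter)
  also have "nat \<lceil>a\<rceil> \<le> N" using assms by (simp add: nat_le_iff ceiling_le_iff)
  then have "real (N - nat \<lceil>a\<rceil>) = real N - of_int \<lceil>a\<rceil>"
    using assms by (simp add: of_nat_diff)
  finally show ?thesis by linarith
qed

lemma count_unit_interval:
  fixes a :: real
  shows "(\<Sum>i<N. of_bool (a \<le> real i \<and> real i < a + 1)) \<le> (1::real)"
proof -
  have "{i \<in> {..<N}. a \<le> real i \<and> real i < a + 1} \<subseteq> {nat \<lceil>a\<rceil>}"
    by (auto simp: nat_eq_iff) linarith+
  then have "card {i \<in> {..<N}. a \<le> real i \<and> real i < a + 1} \<le> 1"
    using card_mono[of "{nat \<lceil>a\<rceil>}"] by fastforce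
  then show ?thesis
    by (simp add: of_bool_def flip: sum.inter_filter)
qed

definition clamp01 :: "real \<Rightarrow> real" where
  "clamp01 x = max 0 (min 1 x)"

lemma continuous_on_clamp01 [continuous_intros]:
  "continuous_on A g \<Longrightarrow> continuous_on A (\<lambda>x. clamp01 (g x))"
  unfolding clamp01_def by (intro continuous_intros)

lemma sum_clamp01_in: "(\<Sum>j<n. clamp01 (g j)) \<in> {0..real n}"
proof -
  have "(\<Sum>j<n. clamp01 (g j)) \<le> (\<Sum>j<n. 1)"
    by (intro sum_mono) (simp add: clamp01_def)
  moreover have "0 \<le> (\<Sum>j<n. clamp01 (g j))"
    by (intro sum_nonneg) (simp add: clamp01_def)
  ultimately show ?thesis by simp
qed

text \<open>
  The \<open>i\<close>-th point leaves \<open>p j\<close> for \<open>p (Suc j)\<close> while \<open>a j\<close> decreases from \<open>i\<close> to \<open>i - 1\<close>. For each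
  \<open>j\<close> at most one integer \<open>i\<close> satisfies \<open>a j \<le> i < a j + 1\<close>, so replacing the position of every point
  by the last \<open>p j\<close> that it has left for or reached changes the sum by at most \<open>2 n B\<close>. Rounding the
  number of points beyond each threshold to \<open>N - a j\<close> costs another \<open>2 n B\<close>.
\<close>

lemma path_sum_near_step_sum:
  fixes a :: "nat \<Rightarrow> real" and f :: "'a \<Rightarrow> real"
  assumes \<gamma>: "\<gamma> ` {0..real n} \<subseteq> S" "\<And>j. j \<le> n \<Longrightarrow> \<gamma> (real j) = p j"
    and mono: "\<And>j k. j \<le> k \<Longrightarrow> k < n \<Longrightarrow> a j \<le> a k"
    and a: "\<And>j. j < n \<Longrightarrow> 0 \<le> a j \<and> a j \<le> real N"
    and B: "\<And>y. y \<in> S \<Longrightarrow> \<bar>f y\<bar> \<le> B"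
  shows "\<bar>(\<Sum>i<N. f (\<gamma> (\<Sum>j<n. clamp01 (real i - a j))))
    - (real N * f (p 0) + (\<Sum>j<n. (real N - a j) * (f (p (Suc j)) - f (p j))))\<bar> \<le> 4 * real n * B"
proof -
  have pS: "p j \<in> S" if "j \<le> n" for j
    using that \<gamma>(1) \<gamma>(2)[OF that, symmetric] by auto
  have \<Delta>: "\<bar>f (p (Suc j)) - f (p j)\<bar> \<le> 2 * B" if "j < n" for j
    using B[OF pS[of j]] B[OF pS[of "Suc j"]] that by auto
  have "B \<ge> 0" using B[OF pS[of 0]] by auto
  define \<phi> where "\<phi> = (\<lambda>i::nat. f (\<gamma> (\<Sum>j<n. clamp01 (real i - a j))))"
  define \<psi> where "\<psi> = (\<lambda>i::nat. f (p 0) + (\<Sum>j<n. of_bool (a j \<le> real i) * (f (p (Suc j)) - f (p j))))"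
  define moving where "moving = (\<lambda>i j. a j \<le> real i \<and> real i < a j + 1)"
  have near: "\<bar>\<phi> i - \<psi> i\<bar> \<le> 2 * B * (\<Sum>j<n. of_bool (moving i j))" for i
  proof -
    define s where "s = (\<Sum>j<n. of_bool (a j \<le> real i) :: nat)"
    have "s \<le> (\<Sum>j<n. 1)" unfolding s_def by (intro sum_mono) simp
    then have s: "s \<le> n" by simp
    have \<psi>: "\<psi> i = f (p s)"
      unfolding \<psi>_def s_def
    proof (rule telescope_initial_segment[where f = "\<lambda>j. f (p j)"])
      show "a k \<le> real i" if "j < n" "a j \<le> real i" "k < j" for j k
        using mono[of k j] that by auto
    qed
    show ?thesis
    proof (cases "\<exists>j<n. moving i j")
      case True
      then obtain j where j: "j < n" "moving i j" by blast
      have "(1::real) = of_bool (moving i j)" using j by simp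
      also have "\<dots> \<le> (\<Sum>j<n. of_bool (moving i j))"
        using j by (intro member_le_sum[of j "{..<n}" "\<lambda>j. of_bool (moving i j)"]) auto
      finally have "2 * B * 1 \<le> 2 * B * (\<Sum>j<n. of_bool (moving i j))"
        by (rule mult_left_mono) (use \<open>B \<ge> 0\<close> in simp)
      moreover have "\<gamma> (\<Sum>j<n. clamp01 (real i - a j)) \<in> S"
        by (rule subsetD[OF \<gamma>(1) imageI[OF sum_clamp01_in]])
      then have "\<bar>\<phi> i\<bar> \<le> B"
        unfolding \<phi>_def by (rule B)
      moreover have "\<bar>\<psi> i\<bar> \<le> B" unfolding \<psi> using B pS s by blast
      ultimately show ?thesis by linarith
    next
      case False
      have "clamp01 (real i - a j) = of_bool (a j \<le> real i)" if "j < n" for j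
        using False that by (auto simp: clamp01_def moving_def)
      then have "(\<Sum>j<n. clamp01 (real i - a j)) = (\<Sum>j<n. of_bool (a j \<le> real i))"
        by (intro sum.cong) auto
      also have "\<dots> = real s" by (simp add: s_def)
      finally have "\<phi> i = \<psi> i" using \<gamma>(2)[OF s] by (simp add: \<phi>_def \<psi>)
      then show ?thesis using \<open>B \<ge> 0\<close> by (simp add: sum_nonneg)
    qed
  qed
  have "\<bar>(\<Sum>i<N. \<phi> i) - (\<Sum>i<N. \<psi> i)\<bar> \<le> (\<Sum>i<N. 2 * B * (\<Sum>j<n. of_bool (moving i j)))"
    unfolding sum_subtractf[symmetric] using near
    by (intro order_trans[OF sum_abs] sum_mono) auto
  also have "\<dots> = 2 * B * (\<Sum>j<n. \<Sum>i<N. of_bool (moving i j))"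
    unfolding sum_distrib_left[symmetric] by (subst sum.swap) (rule refl)
  also have "\<dots> \<le> 2 * B * (\<Sum>j<n. 1)"
    using \<open>B \<ge> 0\<close> unfolding moving_def
    by (intro mult_left_mono sum_mono count_unit_interval) auto
  finally have 1: "\<bar>(\<Sum>i<N. \<phi> i) - (\<Sum>i<N. \<psi> i)\<bar> \<le> 2 * real n * B"
    by (simp add: mult_ac)
  have "(\<Sum>i<N. \<psi> i) = real N * f (p 0) +
      (\<Sum>j<n. (\<Sum>i<N. of_bool (a j \<le> real i)) * (f (p (Suc j)) - f (p j)))"
    unfolding \<psi>_def sum.distrib sum_distrib_right by (subst sum.swap) simp
  then have "(\<Sum>i<N. \<psi> i) - (real N * f (p 0) + (\<Sum>j<n. (real N - a j) * (f (p (Suc j)) - f (p j))))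
     = (\<Sum>j<n. ((\<Sum>i<N. of_bool (a j \<le> real i)) - (real N - a j)) * (f (p (Suc j)) - f (p j)))"
    by (simp only: left_diff_distrib sum_subtractf)
  also have "\<bar>\<dots>\<bar> \<le> (\<Sum>j<n. 1 * (2 * B))"
    using count_above a \<Delta>
    by (intro order_trans[OF sum_abs] sum_mono) (auto simp only: abs_mult lessThan_iff intro!: mult_mono)
  also have "\<dots> = 2 * real n * B" by simp
  finally show ?thesis using 1 unfolding \<phi>_def by linarith
qed

text \<open>
  Taking the thresholds to be \<open>N\<close> times the partial sums of the weights, about \<open>N * l j\<close> of the points
  stand at \<open>p j\<close>. The error bound depends neither on \<open>N\<close> nor on the weights, and the same configuration
  \<open>x l\<close> works for all functions \<open>f\<close> at once.
\<close>

theorem path_sums: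
  fixes p :: "nat \<Rightarrow> 'a::topological_space"
  assumes S: "path_connected S" and p: "\<And>j. j \<le> n \<Longrightarrow> p j \<in> S"
  obtains x :: "(nat \<Rightarrow> real) \<Rightarrow> nat \<Rightarrow> 'a"
  where "\<And>i. continuous_on UNIV (\<lambda>l. x l i)" "\<And>l i. x l i \<in> S"
    "\<And>l f B. (\<And>j. j \<le> n \<Longrightarrow> 0 \<le> l j) \<Longrightarrow> (\<Sum>j\<le>n. l j) = 1 \<Longrightarrow> (\<And>y. y \<in> S \<Longrightarrow> \<bar>f y\<bar> \<le> B) \<Longrightarrow>
      \<bar>(\<Sum>i<N. f (x l i)) - real N * (\<Sum>j\<le>n. l j * f (p j))\<bar> \<le> 4 * real n * B"
proof -
  obtain \<gamma> where \<gamma>: "continuous_on {0..real n} \<gamma>" "\<gamma> ` {0..real n} \<subseteq> S" "\<forall>j\<le>n. \<gamma> (real j) = p j"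
    using path_through_points[OF S, of n p] p by blast
  define a :: "(nat \<Rightarrow> real) \<Rightarrow> nat \<Rightarrow> real" where "a = (\<lambda>l j. real N * (\<Sum>k\<le>j. l k))"
  define x where "x = (\<lambda>l (i::nat). \<gamma> (\<Sum>j<n. clamp01 (real i - a l j)))"
  show thesis
  proof (rule that[of x])
    show "continuous_on UNIV (\<lambda>l. x l i)" for i
      unfolding x_def
    proof (rule continuous_on_compose2[OF \<gamma>(1)])
      show "continuous_on UNIV (\<lambda>l. \<Sum>j<n. clamp01 (real i - a l j))"
        unfolding a_def by (intro continuous_intros continuous_on_product_coordinates)
    qed (rule image_subsetI, rule sum_clamp01_in)
    show "x l i \<in> S" for l i
      unfolding x_def by (rule subsetD[OF \<gamma>(2) imageI[OF sum_clamp01_in]])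
    fix l f B
    assume l: "\<And>j. j \<le> n \<Longrightarrow> 0 \<le> l j" and l1: "(\<Sum>j\<le>n. l j) = (1::real)"
      and B: "\<And>y. y \<in> S \<Longrightarrow> \<bar>f y\<bar> \<le> (B::real)"
    have le: "(\<Sum>k\<le>i. l k) \<le> (\<Sum>k\<le>j. l k)" if "i \<le> j" "j \<le> n" for i j
      using that l by (intro sum_mono2) auto
    have "0 \<le> (\<Sum>k\<le>j. l k)" if "j \<le> n" for j
      using that l by (intro sum_nonneg) auto
    then have "\<bar>(\<Sum>i<N. f (\<gamma> (\<Sum>j<n. clamp01 (real i - a l j))))
        - (real N * f (p 0) + (\<Sum>j<n. (real N - a l j) * (f (p (Suc j)) - f (p j))))\<bar> \<le> 4 * real n * B"
      using \<gamma> le[of _ n] l1 le unfolding a_def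
      by (intro path_sum_near_step_sum[where S = S]) (auto intro!: mult_left_mono mult_left_le B)
    also have "real N * f (p 0) + (\<Sum>j<n. (real N - a l j) * (f (p (Suc j)) - f (p j)))
        = real N * (\<Sum>j\<le>n. l j * f (p j))"
    proof -
      have "(real N - real N * s) * d = real N * ((1 - s) * d)" for s d :: real
        by (simp add: algebra_simps)
      then show ?thesis
        unfolding sum_by_parts[of l "\<lambda>j. f (p j)"] l1 a_def
        by (simp only: sum_distrib_left[symmetric] distrib_left mult_1)
    qed
    finally show "\<bar>(\<Sum>i<N. f (x l i)) - real N * (\<Sum>j\<le>n. l j * f (p j))\<bar> \<le> 4 * real n * B"
      by (simp add: x_def)
  qed
qed

section \<open>Sums of orthonormal functions\<close>

context compact_prob_space
begin

text \<open>
  The weights \<open>W u j\<close> discretise the density \<open>1 + c * (\<Sum>l<m. u l * f l)\<close>, whose \<open>k\<close>-th moment is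
  \<open>c * u k\<close> by orthonormality. The constant \<open>c\<close> keeps the density between \<open>1 / 2\<close> and \<open>3 / 2\<close>, and
  \<open>\<epsilon>\<close> makes the discretisation error of a moment at most \<open>c / 2\<close>. After division by the total weight
  \<open>T u \<le> 3 / 2\<close>, the \<open>k\<close>-th moment is at least \<open>c / 3\<close> in absolute value on the faces \<open>u k = 1\<close> and
  \<open>u k = -1\<close>, with the sign of \<open>u k\<close>. Hence \<open>N * (c / 3)\<close> outgrows the error of \<open>path_sums\<close> together
  with the target \<open>v\<close>.
\<close>

lemma orthonormal_sums:
  fixes f :: "nat \<Rightarrow> 'a \<Rightarrow> real" and v :: "nat \<Rightarrow> real"
  assumes S: "path_connected S"
    and cont: "\<And>k. k < m \<Longrightarrow> continuous_on S (f k)"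
    and mean: "\<And>k. k < m \<Longrightarrow> (\<integral>x. f k x \<partial>M) = 0"
    and orth: "\<And>j k. j < m \<Longrightarrow> k < m \<Longrightarrow> (\<integral>x. f j x * f k x \<partial>M) = of_bool (j = k)"
  shows "\<exists>N0. \<forall>N\<ge>N0. \<exists>x :: nat \<Rightarrow> 'a. (\<forall>i. x i \<in> S) \<and> (\<forall>k<m. (\<Sum>i<N. f k (x i)) = v k)"
proof -
  have "\<exists>b. \<forall>x\<in>S. \<bar>f k x\<bar> \<le> b" if "k < m" for k
    using bounded_cont[OF cont[OF that]] by metis
  then obtain b where b: "\<And>k x. k < m \<Longrightarrow> x \<in> S \<Longrightarrow> \<bar>f k x\<bar> \<le> b k" by metis
  \<comment> \<open>The summand 1 keeps \<open>B\<close> positive, since \<open>c\<close> is defined by division by \<open>B\<close>.\<close>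
  define B where "B = 1 + (\<Sum>k<m. \<bar>b k\<bar>)"
  have B1: "B \<ge> 1" by (simp add: B_def sum_nonneg)
  have B: "\<bar>f k x\<bar> \<le> B" if "k < m" "x \<in> S" for k x
  proof -
    have "\<bar>b k\<bar> \<le> (\<Sum>k<m. \<bar>b k\<bar>)"
      using that by (intro member_le_sum[of k "{..<m}" "\<lambda>k. \<bar>b k\<bar>"]) auto
    then show ?thesis using b[OF that] by (simp add: B_def)
  qed
  define c where "c = 1 / (2 * (real m + 1) * B)"
  have c: "c > 0" using B1 by (simp add: c_def)
  have cmB: "c * (real m * B) \<le> 1 / 2"
  proof -
    have "c * (real m * B) = (1 / 2) * (real m / (real m + 1))"
      using B1 by (simp add: c_def)
    also have "\<dots> \<le> 1 / 2 * 1" by (intro mult_left_mono) auto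
    finally show ?thesis by simp
  qed
  define \<epsilon> where "\<epsilon> = c / (2 * (1 + c * real m))"
  have den: "1 + c * real m > 0" using c by (simp add: add_pos_nonneg)
  then have \<epsilon>: "\<epsilon> > 0" using c by (simp add: \<epsilon>_def)
  have \<epsilon>_eq: "\<epsilon> + c * (real m * \<epsilon>) = c / 2"
  proof -
    have "\<epsilon> + c * (real m * \<epsilon>) = (1 + c * real m) * \<epsilon>" by (simp add: algebra_simps)
    also have "\<dots> = c / 2" using den unfolding \<epsilon>_def by (simp add: field_simps)
    finally show ?thesis .
  qed
  define G where "G = f ` {..<m} \<union> (\<lambda>(l, k) x. f l x * f k x) ` ({..<m} \<times> {..<m})"
  obtain n :: nat and p w where p: "\<And>j. j \<le> n \<Longrightarrow> p j \<in> S"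
    and w: "\<And>j. 0 \<le> w j" "(\<Sum>j\<le>n. w j) = (1::real)"
    and approx: "\<And>g. g \<in> G \<Longrightarrow> \<bar>(\<Sum>j\<le>n. w j * g (p j)) - (\<integral>x. g x \<partial>M)\<bar> \<le> \<epsilon>"
  proof (rule riemann_weights[of G \<epsilon>])
    show "finite G" by (simp add: G_def)
    show "continuous_on S g" if "g \<in> G" for g
      using that cont by (auto simp: G_def intro!: continuous_intros)
  qed (use \<epsilon> in auto)
  have approx1: "\<bar>\<Sum>j\<le>n. w j * f k (p j)\<bar> \<le> \<epsilon>" if "k < m" for k
    using approx[of "f k"] mean that by (auto simp: G_def)
  have approx2: "\<bar>(\<Sum>j\<le>n. w j * (f l (p j) * f k (p j))) - of_bool (l = k)\<bar> \<le> \<epsilon>"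
    if "l < m" "k < m" for l k
    using approx[of "\<lambda>x. f l x * f k x"] orth that by (force simp: G_def)
  define W where "W = (\<lambda>u j. w j * (1 + c * (\<Sum>l<m. u l * f l (p j))))"
  define T where "T = (\<lambda>u. \<Sum>j\<le>n. W u j)"
  have factor: "1 / 2 \<le> 1 + c * (\<Sum>l<m. u l * f l (p j))" "1 + c * (\<Sum>l<m. u l * f l (p j)) \<le> 3 / 2"
    if u: "u \<in> unit_cube m" and j: "j \<le> n" for u j
  proof -
    have "\<bar>\<Sum>l<m. u l * f l (p j)\<bar> \<le> (\<Sum>l<m. 1 * B)"
      using u B p[OF j] unfolding unit_cube_def
      by (intro order_trans[OF sum_abs] sum_mono) (auto simp only: abs_mult lessThan_iff mem_Collect_eq intro!: mult_mono split: if_splits)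
    then have "\<bar>c * (\<Sum>l<m. u l * f l (p j))\<bar> \<le> c * (real m * B)"
      using c by (simp add: abs_mult)
    then have "\<bar>c * (\<Sum>l<m. u l * f l (p j))\<bar> \<le> 1 / 2" using cmB by linarith
    then show "1 / 2 \<le> 1 + c * (\<Sum>l<m. u l * f l (p j))" "1 + c * (\<Sum>l<m. u l * f l (p j)) \<le> 3 / 2"
      by linarith+
  qed
  have W: "0 \<le> W u j" if "u \<in> unit_cube m" "j \<le> n" for u j
    unfolding W_def using w(1) factor(1)[OF that] by (intro mult_nonneg_nonneg) auto
  have T: "1 / 2 \<le> T u" "T u \<le> 3 / 2" if u: "u \<in> unit_cube m" for u
  proof -
    have "(\<Sum>j\<le>n. w j * (1 / 2)) \<le> T u"
      unfolding T_def W_def using w(1) factor(1)[OF u] by (intro sum_mono mult_left_mono) auto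
    then show "1 / 2 \<le> T u" by (simp only: sum_distrib_right[symmetric] w(2) mult_1)
    have "T u \<le> (\<Sum>j\<le>n. w j * (3 / 2))"
      unfolding T_def W_def using w(1) factor(2)[OF u] by (intro sum_mono mult_left_mono) auto
    then show "T u \<le> 3 / 2" by (simp only: sum_distrib_right[symmetric] w(2) mult_1)
  qed
  have moment: "\<bar>(\<Sum>j\<le>n. W u j * f k (p j)) - c * u k\<bar> \<le> c / 2"
    if u: "u \<in> unit_cube m" and k: "k < m" for u k
  proof -
    \<comment> \<open>\<open>E l\<close> is the discretisation error of the inner product of \<open>f l\<close> and \<open>f k\<close>.\<close>
    define E where "E = (\<lambda>l. (\<Sum>j\<le>n. w j * (f l (p j) * f k (p j))) - of_bool (l = k))"
    have "(\<Sum>j\<le>n. W u j * f k (p j))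
        = (\<Sum>j\<le>n. w j * f k (p j)) + c * (\<Sum>l<m. u l * (\<Sum>j\<le>n. w j * (f l (p j) * f k (p j))))"
    proof -
      have "(\<Sum>j\<le>n. W u j * f k (p j))
          = (\<Sum>j\<le>n. w j * f k (p j) + c * (\<Sum>l<m. u l * (w j * (f l (p j) * f k (p j)))))"
        by (intro sum.cong refl) (simp add: W_def algebra_simps sum_distrib_left sum_distrib_right)
      also have "\<dots> = (\<Sum>j\<le>n. w j * f k (p j)) + c * (\<Sum>j\<le>n. \<Sum>l<m. u l * (w j * (f l (p j) * f k (p j))))"
        by (simp only: sum.distrib sum_distrib_left[symmetric])
      finally show ?thesis by (subst (asm) sum.swap) (simp only: sum_distrib_left[symmetric])
    qed
    also have "(\<Sum>l<m. u l * (\<Sum>j\<le>n. w j * (f l (p j) * f k (p j)))) = (\<Sum>l<m. u l * E l + (if l = k then u l else 0))"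
      by (intro sum.cong) (auto simp: E_def algebra_simps)
    also have "\<dots> = (\<Sum>l<m. u l * E l) + u k"
      using k by (simp add: sum.distrib)
    finally have eq: "(\<Sum>j\<le>n. W u j * f k (p j)) - c * u k
        = (\<Sum>j\<le>n. w j * f k (p j)) + c * (\<Sum>l<m. u l * E l)"
      by (simp add: algebra_simps)
    have "\<bar>\<Sum>l<m. u l * E l\<bar> \<le> (\<Sum>l<m. 1 * \<epsilon>)"
      using u approx2 k unfolding unit_cube_def E_def
      by (intro order_trans[OF sum_abs] sum_mono) (auto simp only: abs_mult lessThan_iff mem_Collect_eq intro!: mult_mono split: if_splits)
    then have "\<bar>c * (\<Sum>l<m. u l * E l)\<bar> \<le> c * (real m * \<epsilon>)"
      using c by (simp add: abs_mult)
    then show ?thesis using approx1[OF k] \<epsilon>_eq unfolding eq by linarith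
  qed
  define V where "V = (\<Sum>k<m. \<bar>v k\<bar>)"
  have V: "\<bar>v k\<bar> \<le> V" if "k < m" for k
    unfolding V_def using that by (intro member_le_sum[of k "{..<m}" "\<lambda>k. \<bar>v k\<bar>"]) auto
  define N0 where "N0 = nat \<lceil>(4 * real n * B + V) * 3 / c\<rceil>"
  have "\<exists>x :: nat \<Rightarrow> 'a. (\<forall>i. x i \<in> S) \<and> (\<forall>k<m. (\<Sum>i<N. f k (x i)) = v k)" if N: "N \<ge> N0" for N
  proof -
    have "(4 * real n * B + V) * 3 / c \<le> real N"
      using N unfolding N0_def by linarith
    then have large: "4 * real n * B + V \<le> real N * (c / 3)"
      using c by (simp add: field_simps)
    obtain x where x: "\<And>i. continuous_on UNIV (\<lambda>l. x l i)" "\<And>l i. x l i \<in> S"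
      and xsum: "\<And>l f B. (\<And>j. j \<le> n \<Longrightarrow> 0 \<le> l j) \<Longrightarrow> (\<Sum>j\<le>n. l j) = 1 \<Longrightarrow> (\<And>y. y \<in> S \<Longrightarrow> \<bar>f y\<bar> \<le> B) \<Longrightarrow>
        \<bar>(\<Sum>i<N. f (x l i)) - real N * (\<Sum>j\<le>n. l j * f (p j))\<bar> \<le> 4 * real n * B"
      using path_sums[of S n p N] S p by blast
    define \<Lambda> where "\<Lambda> = (\<lambda>u j. W u j / T u)"
    define F where "F = (\<lambda>k u. (\<Sum>i<N. f k (x (\<Lambda> u) i)) - v k)"
    have F: "\<bar>F k u - real N * ((\<Sum>j\<le>n. W u j * f k (p j)) / T u)\<bar> \<le> 4 * real n * B + V"
      if u: "u \<in> unit_cube m" and k: "k < m" for k u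
    proof -
      have "(\<Sum>j\<le>n. \<Lambda> u j) = 1"
      proof -
        have "(\<Sum>j\<le>n. \<Lambda> u j) = T u / T u"
          unfolding \<Lambda>_def sum_divide_distrib[symmetric] by (simp add: T_def)
        then show ?thesis using T(1)[OF u] by simp
      qed
      moreover have "0 \<le> \<Lambda> u j" if "j \<le> n" for j
        using W[OF u that] T(1)[OF u] by (simp add: \<Lambda>_def)
      ultimately have "\<bar>(\<Sum>i<N. f k (x (\<Lambda> u) i)) - real N * (\<Sum>j\<le>n. \<Lambda> u j * f k (p j))\<bar> \<le> 4 * real n * B"
        using B[OF k] by (intro xsum)
      moreover have "(\<Sum>j\<le>n. \<Lambda> u j * f k (p j)) = (\<Sum>j\<le>n. W u j * f k (p j)) / T u"
        by (simp add: \<Lambda>_def sum_divide_distrib)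
      ultimately show ?thesis using V[OF k] by (simp add: F_def)
    qed
    have "\<exists>u\<in>unit_cube m. \<forall>k<m. F k u = 0"
    proof (rule poincare_miranda)
      show "continuous_on (unit_cube m) (F k)" if "k < m" for k
      proof -
        have \<Lambda>: "continuous_on (unit_cube m) \<Lambda>"
        proof (rule continuous_on_coordinatewise_then_product)
          fix j
          have W: "continuous_on (unit_cube m) (\<lambda>u. W u j)" for j
            unfolding W_def
            by (intro continuous_intros continuous_on_subset[OF continuous_on_product_coordinates]) auto
          show "continuous_on (unit_cube m) (\<lambda>u. \<Lambda> u j)"
            unfolding \<Lambda>_def T_def
            by (intro continuous_intros W) (use T(1) in \<open>force simp: T_def\<close>)
        qed
        have "continuous_on (unit_cube m) (\<lambda>u. x (\<Lambda> u) i)" for i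
          by (rule continuous_on_compose2[OF x(1) \<Lambda>]) auto
        then have "continuous_on (unit_cube m) (\<lambda>u. f k (x (\<Lambda> u) i))" for i
          by (rule continuous_on_compose2[OF cont[OF that]]) (use x(2) in auto)
        then show ?thesis unfolding F_def by (intro continuous_intros)
      qed
      show "F k u \<le> 0" if k: "k < m" and u: "u \<in> unit_cube m" and "u k = -1" for k u
      proof -
        have "(\<Sum>j\<le>n. W u j * f k (p j)) \<le> - (c / 2)"
          using moment[OF u k] unfolding \<open>u k = -1\<close> by linarith
        also have "\<dots> \<le> - (c / 3) * T u" using mult_left_mono[OF T(2)[OF u], of "c / 3"] c by simp
        finally have "(\<Sum>j\<le>n. W u j * f k (p j)) / T u \<le> - (c / 3)"
          using T(1)[OF u] by (simp add: divide_le_eq)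
        then have "real N * ((\<Sum>j\<le>n. W u j * f k (p j)) / T u) \<le> real N * (- (c / 3))"
          by (intro mult_left_mono) auto
        then show ?thesis using F[OF u k] large by linarith
      qed
      show "0 \<le> F k u" if k: "k < m" and u: "u \<in> unit_cube m" and "u k = 1" for k u
      proof -
        have "c / 3 * T u \<le> c / 2" using mult_left_mono[OF T(2)[OF u], of "c / 3"] c by simp
        also have "\<dots> \<le> (\<Sum>j\<le>n. W u j * f k (p j))"
          using moment[OF u k] unfolding \<open>u k = 1\<close> by linarith
        finally have "c / 3 \<le> (\<Sum>j\<le>n. W u j * f k (p j)) / T u"
          using T(1)[OF u] by (simp add: le_divide_eq)
        then have "real N * (c / 3) \<le> real N * ((\<Sum>j\<le>n. W u j * f k (p j)) / T u)"
          by (intro mult_left_mono) auto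
        then show ?thesis using F[OF u k] large by linarith
      qed
    qed
    then obtain u where "\<forall>k<m. F k u = 0" by blast
    then show ?thesis using x(2) by (intro exI[of _ "x (\<Lambda> u)"]) (simp add: F_def)
  qed
  then show ?thesis by (intro exI[of _ N0] allI impI)
qed

end

section \<open>Extension to an averaging multiset\<close>

lemma sum_mset_sum_distrib:
  fixes f :: "'i \<Rightarrow> 'b \<Rightarrow> real"
  shows "(\<Sum>z\<in>#Z. \<Sum>k\<in>K. c k * f k z) = (\<Sum>k\<in>K. c k * (\<Sum>z\<in>#Z. f k z))"
  by (induction Z) (simp_all add: sum.distrib distrib_left)

lemma sum_mset_diff_const:
  fixes g :: "'b \<Rightarrow> real"
  shows "(\<Sum>z\<in>#Z. g z - a) = (\<Sum>z\<in>#Z. g z) - real (size Z) * a"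
  by (induction Z) (simp_all add: algebra_simps)

locale full_support_prob_space = compact_prob_space +
  assumes support: "\<And>U. open U \<Longrightarrow> U \<inter> S \<noteq> {} \<Longrightarrow> emeasure M (U \<inter> S) \<noteq> 0"
begin

text \<open>
  An identity \<open>h = 0\<close> almost everywhere would say nothing about the finitely many points of a design;
  full support upgrades it to an identity on all of \<open>S\<close>.
\<close>

lemma square_integral_zero:
  fixes h :: "'a \<Rightarrow> real"
  assumes h: "continuous_on S h" and 0: "(\<integral>x. h x * h x \<partial>M) = 0" and x: "x \<in> S"
  shows "h x = 0"
proof (rule ccontr)
  assume "h x \<noteq> 0"
  have "\<exists>U. open U \<and> U \<inter> S = h -` (- {0}) \<inter> S"
    using h open_delete[OF open_UNIV, of "0::real"] unfolding continuous_on_open_invariant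
    by (simp add: Compl_eq_Diff_UNIV)
  then obtain U where U: "open U" "U \<inter> S = h -` (- {0}) \<inter> S" by blast
  have "integrable M (\<lambda>x. h x * h x)"
    by (intro integrable_cont continuous_intros h)
  then have "AE x in M. h x * h x = 0"
    using 0 integral_nonneg_eq_0_iff_AE[of M "\<lambda>x. h x * h x"] by simp
  moreover have "{x \<in> space M. \<not> h x * h x = 0} = U \<inter> S"
    using U(2) by (auto simp: space_eq)
  moreover have "U \<inter> S \<in> sets M"
    unfolding sets_eq sets_restrict_space using U(1) by (subst Int_commute) (rule imageI, simp)
  ultimately have "emeasure M (U \<inter> S) = 0"
    using AE_iff_measurable[of "U \<inter> S" M "\<lambda>x. h x * h x = 0"] by simp
  moreover have "x \<in> U \<inter> S" using U(2) x \<open>h x \<noteq> 0\<close> by auto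
  ultimately show False using support[OF U(1)] by blast
qed

text \<open>
  Functions that depend linearly on the earlier ones are dropped, so the family may be shorter than
  \<open>G\<close>. Mean zero is inherited by linear combinations.
\<close>

lemma gram_schmidt:
  fixes G :: "('a \<Rightarrow> real) set"
  assumes "finite G" "\<And>g. g \<in> G \<Longrightarrow> continuous_on S g" "\<And>g. g \<in> G \<Longrightarrow> (\<integral>x. g x \<partial>M) = 0"
  shows "\<exists>(m::nat) f. (\<forall>k<m. continuous_on S (f k) \<and> (\<integral>x. f k x \<partial>M) = 0) \<and>
    (\<forall>j<m. \<forall>k<m. (\<integral>x. f j x * f k x \<partial>M) = of_bool (j = k)) \<and>
    (\<forall>g\<in>G. \<exists>c. \<forall>x\<in>S. g x = (\<Sum>k<m. c k * f k x :: real))"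
  using assms
proof (induction G rule: finite_induct)
  case empty
  then show ?case by (intro exI[of _ 0]) simp
next
  case (insert g G)
  have "\<exists>(m::nat) f. (\<forall>k<m. continuous_on S (f k) \<and> (\<integral>x. f k x \<partial>M) = 0) \<and>
    (\<forall>j<m. \<forall>k<m. (\<integral>x. f j x * f k x \<partial>M) = of_bool (j = k)) \<and>
    (\<forall>g\<in>G. \<exists>c. \<forall>x\<in>S. g x = (\<Sum>k<m. c k * f k x :: real))"
    using insert.prems by (intro insert.IH) auto
  then obtain m :: nat and f where f: "\<And>k. k < m \<Longrightarrow> continuous_on S (f k)"
      "\<And>k. k < m \<Longrightarrow> (\<integral>x. f k x \<partial>M) = 0"
    and orth: "\<And>j k. j < m \<Longrightarrow> k < m \<Longrightarrow> (\<integral>x. f j x * f k x \<partial>M) = of_bool (j = k)"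
    and span: "\<And>g. g \<in> G \<Longrightarrow> \<exists>c. \<forall>x\<in>S. g x = (\<Sum>k<m. c k * f k x :: real)"
    by blast
  have g: "continuous_on S g" "(\<integral>x. g x \<partial>M) = 0" using insert.prems by auto
  define c where "c = (\<lambda>k. \<integral>x. g x * f k x \<partial>M)"
  define h where "h = (\<lambda>x. g x - (\<Sum>k<m. c k * f k x))"
  have h: "continuous_on S h"
    unfolding h_def by (intro continuous_intros g f) simp
  have h0: "(\<integral>x. h x \<partial>M) = 0"
  proof -
    have "(\<integral>x. h x \<partial>M) = (\<integral>x. g x \<partial>M) - (\<integral>x. (\<Sum>k<m. c k * f k x) \<partial>M)"
      unfolding h_def
      by (intro Bochner_Integration.integral_diff integrable_cont continuous_intros g f) simp
    also have "(\<integral>x. (\<Sum>k<m. c k * f k x) \<partial>M) = (\<Sum>k<m. \<integral>x. c k * f k x \<partial>M)"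
      by (intro Bochner_Integration.integral_sum integrable_cont continuous_intros f) simp
    finally show ?thesis using g(2) f(2) by simp
  qed
  have hf: "(\<integral>x. h x * f j x \<partial>M) = 0" if j: "j < m" for j
  proof -
    have "(\<integral>x. h x * f j x \<partial>M) = (\<integral>x. g x * f j x - (\<Sum>k<m. c k * (f k x * f j x)) \<partial>M)"
      by (simp add: h_def left_diff_distrib sum_distrib_right mult.assoc)
    also have "\<dots> = (\<integral>x. g x * f j x \<partial>M) - (\<integral>x. (\<Sum>k<m. c k * (f k x * f j x)) \<partial>M)"
      using j by (intro Bochner_Integration.integral_diff integrable_cont continuous_intros g f) auto
    also have "(\<integral>x. (\<Sum>k<m. c k * (f k x * f j x)) \<partial>M) = (\<Sum>k<m. \<integral>x. c k * (f k x * f j x) \<partial>M)"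
      using j by (intro Bochner_Integration.integral_sum integrable_cont continuous_intros f) auto
    also have "\<dots> = (\<Sum>k<m. if k = j then c k else 0)"
      using orth j by (intro sum.cong) auto
    also have "\<dots> = c j" using j by simp
    finally show ?thesis by (simp add: c_def)
  qed
  define s where "s = (\<integral>x. h x * h x \<partial>M)"
  have "s \<ge> 0" unfolding s_def by (intro Bochner_Integration.integral_nonneg) simp
  show ?case
  proof (cases "s = 0")
    case True
    have "h x = 0" if "x \<in> S" for x
      by (rule square_integral_zero[OF h _ that]) (use True in \<open>simp add: s_def\<close>)
    then have "\<forall>x\<in>S. g x = (\<Sum>k<m. c k * f k x)" by (simp add: h_def)
    then show ?thesis using f orth span by (intro exI[of _ m] exI[of _ f]) auto
  next
    case False
    then have s: "s > 0" using \<open>s \<ge> 0\<close> by simp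
    define f' where "f' = (\<lambda>k x. if k < m then f k x else h x / sqrt s)"
    have old: "f' k = f k" if "k < m" for k using that by (simp add: f'_def)
    have new: "f' m = (\<lambda>x. h x / sqrt s)" by (simp add: f'_def)
    have 1: "continuous_on S (f' k) \<and> (\<integral>x. f' k x \<partial>M) = 0" if "k < Suc m" for k
      using that f h h0 s by (cases "k = m") (auto simp: old new intro!: continuous_intros)
    have 2: "(\<integral>x. f' j x * f' k x \<partial>M) = of_bool (j = k)" if "j < Suc m" "k < Suc m" for j k
    proof -
      have fh: "(\<integral>x. f i x * h x \<partial>M) = 0" if "i < m" for i
        using hf[OF that] by (simp add: mult.commute)
      show ?thesis
        using that orth hf fh s
        by (cases "j = m"; cases "k = m") (auto simp: old new s_def[symmetric])
    qed
    have 3: "\<exists>c. \<forall>x\<in>S. g' x = (\<Sum>k<Suc m. c k * f' k x)" if "g' \<in> insert g G" for g'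
    proof (cases "g' = g")
      case True
      have "g x = (\<Sum>k<Suc m. (if k < m then c k else sqrt s) * f' k x)" for x
        using s by (simp add: old new h_def)
      then show ?thesis
        unfolding True by (intro exI[of _ "\<lambda>k. if k < m then c k else sqrt s"] ballI)
    next
      case False
      then have "g' \<in> G" using that by simp
      from span[OF this] obtain b where "\<forall>x\<in>S. g' x = (\<Sum>k<m. b k * f k x)" ..
      then have "\<forall>x\<in>S. g' x = (\<Sum>k<Suc m. (if k < m then b k else 0) * f' k x)"
        by (simp add: old)
      then show ?thesis by (rule exI[of _ "\<lambda>k. if k < m then b k else 0"])
    qed
    show ?thesis using 1 2 3 by blast
  qed
qed

text \<open>
  After subtracting the means, an orthonormal family \<open>f\<close> spans the functions in question, and it is
  enough that the sums of the \<open>f k\<close> over \<open>X\<close> cancel those over \<open>Y\<close>.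
\<close>

theorem averaging_multiset_extension:
  fixes G :: "('a \<Rightarrow> real) set" and Y :: "'a multiset"
  assumes S: "path_connected S"
    and G: "finite G" "\<And>g. g \<in> G \<Longrightarrow> continuous_on S g"
    and Y: "set_mset Y \<subseteq> S"
  shows "\<exists>N0. \<forall>N\<ge>N0. \<exists>X. size X = N \<and> set_mset X \<subseteq> S \<and>
    (\<forall>g\<in>G. (\<Sum>z\<in>#X + Y. g z) = real (size (X + Y)) * (\<integral>x. g x \<partial>M))"
proof -
  define G0 where "G0 = (\<lambda>g x. g x - (\<integral>x. g x \<partial>M)) ` G"
  have "\<exists>(m::nat) f. (\<forall>k<m. continuous_on S (f k) \<and> (\<integral>x. f k x \<partial>M) = 0) \<and>
    (\<forall>j<m. \<forall>k<m. (\<integral>x. f j x * f k x \<partial>M) = of_bool (j = k)) \<and>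
    (\<forall>g\<in>G0. \<exists>c. \<forall>x\<in>S. g x = (\<Sum>k<m. c k * f k x :: real))"
  proof (rule gram_schmidt)
    show "finite G0" using G(1) by (simp add: G0_def)
    show "continuous_on S g" if "g \<in> G0" for g
      using that G(2) by (auto simp: G0_def intro!: continuous_intros)
    show "(\<integral>x. g x \<partial>M) = 0" if "g \<in> G0" for g
      using that integrable_cont[OF G(2)] by (auto simp: G0_def prob_space)
  qed
  then obtain m :: nat and f where f: "\<And>k. k < m \<Longrightarrow> continuous_on S (f k)"
      "\<And>k. k < m \<Longrightarrow> (\<integral>x. f k x \<partial>M) = 0"
      "\<And>j k. j < m \<Longrightarrow> k < m \<Longrightarrow> (\<integral>x. f j x * f k x \<partial>M) = of_bool (j = k)"
    and span: "\<And>g. g \<in> G0 \<Longrightarrow> \<exists>c. \<forall>x\<in>S. g x = (\<Sum>k<m. c k * f k x :: real)"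
    by blast
  have "\<exists>N0. \<forall>N\<ge>N0. \<exists>x :: nat \<Rightarrow> 'a. (\<forall>i. x i \<in> S) \<and> (\<forall>k<m. (\<Sum>i<N. f k (x i)) = - (\<Sum>y\<in>#Y. f k y))"
    by (rule orthonormal_sums[OF S f])
  then obtain N0 where N0: "\<And>N. N \<ge> N0 \<Longrightarrow> \<exists>x :: nat \<Rightarrow> 'a. (\<forall>i. x i \<in> S) \<and> (\<forall>k<m. (\<Sum>i<N. f k (x i)) = - (\<Sum>y\<in>#Y. f k y))"
    by blast
  show ?thesis
  proof (intro exI[of _ N0] allI impI)
    fix N assume "N0 \<le> N"
    then obtain x where x: "\<And>i. x i \<in> S" "\<And>k. k < m \<Longrightarrow> (\<Sum>i<N. f k (x i)) = - (\<Sum>y\<in>#Y. f k y)"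
      using N0 by blast
    define X where "X = image_mset x (mset_set {..<N})"
    have XS: "set_mset X \<subseteq> S" using x(1) by (auto simp: X_def)
    have "(\<Sum>z\<in>#X + Y. g z) = real (size (X + Y)) * (\<integral>x. g x \<partial>M)" if g: "g \<in> G" for g
    proof -
      obtain c where c: "\<forall>x\<in>S. g x - (\<integral>x. g x \<partial>M) = (\<Sum>k<m. c k * f k x)"
        using span[of "\<lambda>x. g x - (\<integral>x. g x \<partial>M)"] g by (auto simp: G0_def)
      have "(\<Sum>z\<in>#X + Y. f k z) = 0" if "k < m" for k
        using x(2)[OF that] by (simp add: X_def sum_unfold_sum_mset multiset.map_comp o_def)
      then have "(\<Sum>z\<in>#X + Y. \<Sum>k<m. c k * f k z) = 0"
        unfolding sum_mset_sum_distrib by simp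
      moreover have "(\<Sum>z\<in>#X + Y. \<Sum>k<m. c k * f k z) = (\<Sum>z\<in>#X + Y. g z - (\<integral>x. g x \<partial>M))"
        using c XS Y by (intro arg_cong[where f = sum_mset] image_mset_cong) auto
      moreover have "(\<Sum>z\<in>#X + Y. g z - (\<integral>x. g x \<partial>M)) = (\<Sum>z\<in>#X + Y. g z) - real (size (X + Y)) * (\<integral>x. g x \<partial>M)"
        by (rule sum_mset_diff_const)
      ultimately show ?thesis by simp
    qed
    moreover have "size X = N" by (simp add: X_def)
    ultimately show "\<exists>X. size X = N \<and> set_mset X \<subseteq> S \<and>
        (\<forall>g\<in>G. (\<Sum>z\<in>#X + Y. g z) = real (size (X + Y)) * (\<integral>x. g x \<partial>M))"
      using XS by blast
  qed
qed

end

section \<open>Spherical designs\<close>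

lemma prob_space_sphere_measure: "prob_space (sphere_measure :: 'a::euclidean_space measure)"
  by (rule prob_spaceI) (simp add: emeasure_space_sphere_measure)

text \<open>
  The cone over a nonempty relatively open part of the sphere contains a nonempty open set, since \<open>sgn\<close>
  is continuous away from the origin.
\<close>

lemma full_support_sphere_measure:
  "full_support_prob_space (sphere_measure :: 'a::euclidean_space measure) (sphere 0 1)"
proof (intro full_support_prob_space.intro compact_prob_space.intro prob_space_sphere_measure
    compact_prob_space_axioms.intro full_support_prob_space_axioms.intro)
  show "compact (sphere (0::'a) 1)" by simp
  show "space sphere_measure = sphere (0::'a) 1" by simp
  show "sets sphere_measure = sets (restrict_space borel (sphere (0::'a) 1))"
    by (rule sets_sphere_measure)
  fix U :: "'a set" assume U: "open U" "U \<inter> sphere 0 1 \<noteq> {}"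
  let ?A = "U \<inter> sphere 0 1"
  have "?A \<in> sets borel" using U(1) by auto
  then have eq: "emeasure sphere_measure ?A
      = emeasure lborel (ball 0 1 \<inter> sgn -` ?A) / emeasure lborel (ball 0 1 :: 'a set)"
    by (simp only: emeasure_sphere_measure[OF _ Int_lower2] cone_eq[OF Int_lower2])
  define V where "V = ball 0 1 \<inter> ((- {0}) \<inter> sgn -` U)"
  have "continuous_on (- {0}) (sgn :: 'a \<Rightarrow> 'a)"
    unfolding sgn_div_norm by (intro continuous_intros) auto
  then have "open V"
    unfolding V_def using U(1) by (intro open_Int continuous_open_preimage) auto
  moreover obtain x where x: "x \<in> U" "norm x = 1" using U(2) by auto
  have "(1 / 2) *\<^sub>R x \<in> V"
    using x by (auto simp: V_def sgn_scaleR) (simp add: sgn_div_norm)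
  ultimately have "emeasure lborel V \<noteq> 0"
    using open_not_negligible[of V] by (auto simp: negligible_iff_null_sets null_sets_def)
  moreover have "V \<subseteq> ball 0 1 \<inter> sgn -` ?A"
    by (auto simp: V_def norm_sgn)
  moreover have "ball 0 1 \<inter> sgn -` ?A \<in> sets lborel"
    using sgn_vimage_borel[OF \<open>?A \<in> sets borel\<close>] by auto
  ultimately have "emeasure lborel (ball 0 1 \<inter> sgn -` ?A) \<noteq> 0"
    using emeasure_mono[of V _ lborel] by (metis le_zero_eq)
  moreover have "emeasure lborel (ball 0 1 :: 'a set) \<noteq> top"
    using emeasure_lborel_ball_finite[of "0::'a" 1] by simp
  ultimately show "emeasure sphere_measure ?A \<noteq> 0"
    unfolding eq by (simp add: ennreal_divide_eq_0_iff)
qed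

definition monomial_eval :: "('n \<Rightarrow>\<^sub>0 nat) \<Rightarrow> real ^ 'n::finite \<Rightarrow> real" where
  "monomial_eval m x = (\<Prod>i\<in>UNIV. (x $ i) ^ Poly_Mapping.lookup m i)"

lemma continuous_on_monomial_eval: "continuous_on A (monomial_eval m)"
  unfolding monomial_eval_def by (intro continuous_intros)

lemma finite_exponents_le:
  "finite {m :: 'n::finite \<Rightarrow>\<^sub>0 nat. (\<Sum>i\<in>UNIV. Poly_Mapping.lookup m i) \<le> t}" (is "finite ?E")
proof (rule finite_imageD)
  have "Poly_Mapping.lookup m i \<le> t" if "m \<in> ?E" for m i
    using member_le_sum[of i UNIV "Poly_Mapping.lookup m"] that by simp
  then have "Poly_Mapping.lookup ` ?E \<subseteq> PiE UNIV (\<lambda>_. {..t})"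
    by auto
  then show "finite (Poly_Mapping.lookup ` ?E)"
    by (rule finite_subset) (intro finite_PiE finite_class.finite_UNIV finite_atMost)
  show "inj_on Poly_Mapping.lookup ?E"
    by (rule inj_onI) (rule lookup_inject[THEN iffD1])
qed

lemma exponent_le_mpoly_degree:
  "m \<in> Poly_Mapping.keys P \<Longrightarrow> (\<Sum>i\<in>UNIV. Poly_Mapping.lookup m i) \<le> mpoly_degree P"
  unfolding mpoly_degree_def by (intro Max_ge) auto

text \<open>
  Polynomials of degree at most \<open>t\<close> are combinations of finitely many monomials, and the sphere in
  \<open>\<real>\<^sup>d\<^sup>+\<^sup>1\<close> is path connected because \<open>d + 1 \<ge> 2\<close>.
\<close>

theorem corollary1:
  fixes d t1 t :: nat
    and Y :: "(real ^ 'n::finite) multiset"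
  assumes "1 \<le> d" and "CARD('n) = d + 1"
    and "1 \<le> t1" and "t1 < t"
    and "spherical_design t1 Y"
  shows "\<exists>N0. \<forall>N\<ge>N0. \<exists>X :: (real ^ 'n) multiset.
           size X = N \<and> set_mset X \<subseteq> sphere 0 1 \<and> spherical_design t (X + Y)"
proof -
  interpret full_support_prob_space sphere_measure "sphere (0 :: real ^ 'n) 1"
    by (rule full_support_sphere_measure)
  have Y: "Y \<noteq> {#}" "set_mset Y \<subseteq> sphere 0 1"
    using assms(5) by (auto simp: spherical_design_def)
  define G :: "(real ^ 'n \<Rightarrow> real) set"
    where "G = monomial_eval ` {m. (\<Sum>i\<in>UNIV. Poly_Mapping.lookup m i) \<le> t}"
  have "path_connected (sphere (0 :: real ^ 'n) 1)"
    using assms(1,2) by (intro path_connected_sphere) simp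
  then have "\<exists>N0. \<forall>N\<ge>N0. \<exists>X. size X = N \<and> set_mset X \<subseteq> sphere 0 1 \<and>
      (\<forall>g\<in>G. (\<Sum>z\<in>#X + Y. g z) = real (size (X + Y)) * (\<integral>x. g x \<partial>sphere_measure))"
    using finite_exponents_le continuous_on_monomial_eval Y(2) unfolding G_def
    by (intro averaging_multiset_extension) auto
  moreover have "spherical_design t (X + Y)"
    if X: "set_mset X \<subseteq> sphere 0 1"
      and avg: "\<forall>g\<in>G. (\<Sum>z\<in>#X + Y. g z) = real (size (X + Y)) * (\<integral>x. g x \<partial>sphere_measure)"
    for X
    unfolding spherical_design_def
  proof (intro conjI allI impI)
    show "X + Y \<noteq> {#}" "set_mset (X + Y) \<subseteq> sphere 0 1" using X Y by auto
    fix P :: "'n real_mpoly" assume deg: "mpoly_degree P \<le> t"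
    let ?I = "\<lambda>g. \<integral>x. g x \<partial>sphere_measure"
    let ?c = "Poly_Mapping.lookup P"
    have P: "mpoly_eval P = (\<lambda>x. \<Sum>m\<in>Poly_Mapping.keys P. ?c m * monomial_eval m x)"
      by (simp add: fun_eq_iff mpoly_eval_def monomial_eval_def)
    have "(\<Sum>z\<in>#X + Y. mpoly_eval P z) = (\<Sum>m\<in>Poly_Mapping.keys P. ?c m * (\<Sum>z\<in>#X + Y. monomial_eval m z))"
      unfolding P by (rule sum_mset_sum_distrib)
    also have "\<dots> = (\<Sum>m\<in>Poly_Mapping.keys P. ?c m * (real (size (X + Y)) * ?I (monomial_eval m)))"
      using avg exponent_le_mpoly_degree deg unfolding G_def
      by (intro sum.cong refl arg_cong2[where f = "(*)"]) (auto intro: order_trans)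
    also have "\<dots> = real (size (X + Y)) * (\<Sum>m\<in>Poly_Mapping.keys P. ?I (\<lambda>x. ?c m * monomial_eval m x))"
      by (simp add: sum_distrib_left mult.left_commute)
    also have "(\<Sum>m\<in>Poly_Mapping.keys P. ?I (\<lambda>x. ?c m * monomial_eval m x)) = ?I (mpoly_eval P)"
      unfolding P
      by (intro Bochner_Integration.integral_sum[symmetric] integrable_cont continuous_intros
          continuous_on_monomial_eval)
    finally have "(\<Sum>z\<in>#X + Y. mpoly_eval P z) = real (size (X + Y)) * ?I (mpoly_eval P)" .
    moreover have "b = 1 / k * a" if "a = k * b" "k \<noteq> 0" for a b k :: real
      using that by simp
    moreover have "real (size (X + Y)) \<noteq> 0"
      using Y(1) by (metis of_nat_eq_0_iff size_eq_0_iff_empty union_eq_empty)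
    ultimately show "?I (mpoly_eval P) = 1 / real (size (X + Y)) * (\<Sum>z\<in>#X + Y. mpoly_eval P z)"
      by blast
  qed
  ultimately show ?thesis by metis
qed

end
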